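(* For every $N$, every finite hypergraph $(B,S)$ admits a fully symmetric finite covering by an $N$-acyclic hypergraph.
   Context: A hypergraph $(A,U)$ consists of a vertex set $A$ and a set $U$ of finite non-empty subsets of $A$ (hyperedges) with $A=\bigcup U$. Its Gaifman graph links distinct $a,a'\in A$ if they lie in a common hyperedge. $(A,U)$ is acyclic if its Gaifman graph has no chordless cycles of length greater than $3$ and every clique in the Gaifman graph is contained in some hyperedge. It is $N$-acyclic if every induced sub-hypergraph (vertex set $A_0\subseteq A$, hyperedges the non-empty sets $u\cap A_0$, $u\in U$) with up to $N$ vertices is acyclic. A symmetry of $(A,U)$ is a permutation of $A$ that preserves $U$ as a set of subsets of $A$. A homomorphism $\pi\colon(A,U)\to(B,S)$ is a map $\pi\colon A\to B$ whose restriction to each hyperedge $u\in U$ maps $u$ bijectively onto a hyperedge $\pi(u)\in S$. It is a covering of $(B,S)$ by $(A,U)$ if it maps $U$ surjectively onto $S$ and satisfies the lifting property: for every pair of hyperedges $s,s'\in S$ with non-empty intersection and every $u\in U$ with $\pi(u)=s$ there is some $u'\in U$ such that $\pi(u')=s'$ and $s\cap s'=\pi(u\cap u')$ (equivalently, $\pi$ restricts to a bijection of $u\cup u'$ onto $s\cup s'$). The covering is finite if $(A,U)$ is finite. A symmetry of the covering $\pi$ is a pair $(f,h)$ of a symmetry $f$ of $(A,U)$ and a symmetry $h$ of $(B,S)$ with $\pi\circ f=h\circ\pi$; it extends $h$, and it is $B$-rigid if $h=\mathrm{id}_B$. The covering is fully symmetric over $(B,S)$ if every symmetry of $(B,S)$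 extends to a symmetry of the covering and the group of $B$-rigid symmetries acts transitively on $\pi^{-1}(s)=\{u\in U\colon\pi(u)=s\}$ for every $s\in S$. *)

theory Defs
  imports Main "HOL-Combinatorics.Permutations"
begin

definition hypergraph :: "'a set \<Rightarrow> 'a set set \<Rightarrow> bool" where
  "hypergraph A U \<longleftrightarrow> (\<forall>u\<in>U. finite u \<and> u \<noteq> {}) \<and> A = \<Union>U"

definition gaifman_adj :: "'a set set \<Rightarrow> 'a \<Rightarrow> 'a \<Rightarrow> bool" where
  "gaifman_adj U a a' \<longleftrightarrow> a \<noteq> a' \<and> (\<exists>u\<in>U. a \<in> u \<and> a' \<in> u)"

text \<open>
  A cycle is given by the list of its pairwise distinct vertices in cyclic order. The equivalence
  says both that cyclically consecutive vertices are adjacent and that there is no chord.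
\<close>
definition chordless_cycle :: "'a set \<Rightarrow> 'a set set \<Rightarrow> 'a list \<Rightarrow> bool" where
  "chordless_cycle A U c \<longleftrightarrow>
     3 \<le> length c \<and> distinct c \<and> set c \<subseteq> A \<and>
     (\<forall>i<length c. \<forall>j<length c.
        gaifman_adj U (c ! i) (c ! j) \<longleftrightarrow>
          j = Suc i mod length c \<or> i = Suc j mod length c)"

text \<open>
  Cliques are non-empty. Otherwise the hypergraph without vertices, which is an induced
  sub-hypergraph of every hypergraph, would fail to be acyclic.
\<close>
definition gaifman_clique :: "'a set \<Rightarrow> 'a set set \<Rightarrow> 'a set \<Rightarrow> bool" where
  "gaifman_clique A U K \<longleftrightarrow>
     K \<noteq> {} \<and> K \<subseteq> A \<and> (\<forall>a\<in>K. \<forall>a'\<in>K. a \<noteq> a' \<longrightarrow> gaifman_adj U a a')"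

definition acyclic_hypergraph :: "'a set \<Rightarrow> 'a set set \<Rightarrow> bool" where
  "acyclic_hypergraph A U \<longleftrightarrow>
     (\<nexists>c. chordless_cycle A U c \<and> length c > 3) \<and>
     (\<forall>K. gaifman_clique A U K \<longrightarrow> (\<exists>u\<in>U. K \<subseteq> u))"

definition induced_hyperedges :: "'a set set \<Rightarrow> 'a set \<Rightarrow> 'a set set" where
  "induced_hyperedges U A0 = {u \<inter> A0 |u. u \<in> U \<and> u \<inter> A0 \<noteq> {}}"

definition N_acyclic_hypergraph :: "nat \<Rightarrow> 'a set \<Rightarrow> 'a set set \<Rightarrow> bool" where
  "N_acyclic_hypergraph N A U \<longleftrightarrow>
     (\<forall>A0\<subseteq>A. finite A0 \<and> card A0 \<le> N \<longrightarrow> acyclic_hypergraph A0 (induced_hyperedges U A0))"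

text \<open>
  A permutation of the vertex set is a function on the whole type that is the identity off that
  set (\<^const>\<open>permutes\<close>), so that equal symmetries are equal functions.
\<close>
definition hypergraph_symmetry :: "'a set \<Rightarrow> 'a set set \<Rightarrow> ('a \<Rightarrow> 'a) \<Rightarrow> bool" where
  "hypergraph_symmetry A U f \<longleftrightarrow> f permutes A \<and> (\<lambda>u. f ` u) ` U = U"

definition hypergraph_hom ::
  "'a set \<Rightarrow> 'a set set \<Rightarrow> 'b set \<Rightarrow> 'b set set \<Rightarrow> ('a \<Rightarrow> 'b) \<Rightarrow> bool" where
  "hypergraph_hom A U B S p \<longleftrightarrow>
     p ` A \<subseteq> B \<and> (\<forall>u\<in>U. inj_on p u \<and> p ` u \<in> S)"

definition hypergraph_covering ::
  "'a set \<Rightarrow> 'a set set \<Rightarrow> 'b set \<Rightarrow> 'b set set \<Rightarrow> ('a \<Rightarrow> 'b) \<Rightarrow> bool" where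
  "hypergraph_covering A U B S p \<longleftrightarrow>
     hypergraph_hom A U B S p \<and>
     (\<lambda>u. p ` u) ` U = S \<and>
     (\<forall>s\<in>S. \<forall>s'\<in>S. s \<inter> s' \<noteq> {} \<longrightarrow>
        (\<forall>u\<in>U. p ` u = s \<longrightarrow>
           (\<exists>u'\<in>U. p ` u' = s' \<and> s \<inter> s' = p ` (u \<inter> u'))))"

definition covering_symmetry ::
  "'a set \<Rightarrow> 'a set set \<Rightarrow> 'b set \<Rightarrow> 'b set set \<Rightarrow> ('a \<Rightarrow> 'b) \<Rightarrow>
     ('a \<Rightarrow> 'a) \<Rightarrow> ('b \<Rightarrow> 'b) \<Rightarrow> bool" where
  "covering_symmetry A U B S p f h \<longleftrightarrow>
     hypergraph_symmetry A U f \<and> hypergraph_symmetry B S h \<and> (\<forall>a\<in>A. p (f a) = h (p a))"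

definition fully_symmetric_over ::
  "'a set \<Rightarrow> 'a set set \<Rightarrow> 'b set \<Rightarrow> 'b set set \<Rightarrow> ('a \<Rightarrow> 'b) \<Rightarrow> bool" where
  "fully_symmetric_over A U B S p \<longleftrightarrow>
     (\<forall>h. hypergraph_symmetry B S h \<longrightarrow> (\<exists>f. covering_symmetry A U B S p f h)) \<and>
     (\<forall>s\<in>S. \<forall>u\<in>{u\<in>U. p ` u = s}. \<forall>u'\<in>{u\<in>U. p ` u = s}.
        \<exists>f. covering_symmetry A U B S p f id \<and> f ` u = u')"

end

theory Submission imports Defs "HOL-Library.FuncSet"
begin

text \<open>
  Take a finite group \<open>G\<close> generated by involutions \<open>(s, s')\<close>, one for each pair of hyperedges, that
  acts on \<open>S\<close> with \<open>(s, s')\<close> swapping \<open>s\<close> and \<open>s'\<close>. Over the hyperedge \<open>s\<close> put the copies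
  \<open>(s, g)\<close> with \<open>g \<in> G\<close>, and let the vertices over \<open>b\<close> be the orbits in \<open>S \<times> G\<close> of the subgroup
  generated by the pairs of hyperedges that contain \<open>b\<close>. These generators permute the hyperedges
  through \<open>b\<close>, so an orbit that meets a copy of a hyperedge through \<open>b\<close> consists of such copies.
  Left multiplication in \<open>G\<close> makes the fibres homogeneous, and symmetries of \<open>(B, S)\<close> lift because
  \<open>G\<close> is canonical. A chordless cycle or a clique outside all hyperedges would yield a cycle of at
  most \<open>N\<close> consecutively intersecting cosets of subgroups generated by generators such that no three
  consecutive ones have a common element. The group \<open>G\<close> excludes these: glue the cosets
  of the cycle to an open chain, let a generator fix every point where its edge is missing, and
  make sure that \<open>G\<close> acts on this chain. A word that goes round the cycle in \<open>G\<close> moves the first point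
  of the chain to its last part, hence is not a relator.
\<close>

section \<open>Involutive actions and orbits\<close>

definition orbit :: "('e \<Rightarrow> 'x \<Rightarrow> 'x) \<Rightarrow> 'e set \<Rightarrow> 'x \<Rightarrow> 'x set" where
  "orbit act \<alpha> x = (\<lambda>w. fold act w x) ` lists \<alpha>"

definition involutions_on :: "'x set \<Rightarrow> 'e set \<Rightarrow> ('e \<Rightarrow> 'x \<Rightarrow> 'x) \<Rightarrow> bool" where
  "involutions_on X \<alpha> act \<longleftrightarrow> (\<forall>e\<in>\<alpha>. \<forall>x\<in>X. act e x \<in> X \<and> act e (act e x) = x)"

lemma involutions_on_subset: "involutions_on X \<alpha> act \<Longrightarrow> \<beta> \<subseteq> \<alpha> \<Longrightarrow> involutions_on X \<beta> act"
  unfolding involutions_on_def by blast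

lemma fold_in:
  assumes "involutions_on X \<alpha> act" "w \<in> lists \<alpha>" "x \<in> X"
  shows "fold act w x \<in> X"
  using assms(2,3) by (induction w arbitrary: x) (use assms(1) in \<open>auto simp: involutions_on_def\<close>)

lemma fold_rev_fold:
  assumes "involutions_on X \<alpha> act" "w \<in> lists \<alpha>" "x \<in> X"
  shows "fold act (rev w) (fold act w x) = x"
  using assms(2,3) by (induction w arbitrary: x) (use assms(1) in \<open>auto simp: involutions_on_def\<close>)

lemma fold_append_rev:
  assumes "involutions_on X \<alpha> act" "w \<in> lists \<alpha>" "w' \<in> lists \<alpha>" "x \<in> X"
  shows "fold act (w @ rev w') x = x \<longleftrightarrow> fold act w x = fold act w' x"
proof
  assume "fold act (w @ rev w') x = x"
  then have "fold act (rev (rev w')) (fold act (rev w') (fold act w x)) = fold act w' x" by simp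
  moreover have "fold act (rev (rev w')) (fold act (rev w') (fold act w x)) = fold act w x"
    using assms by (intro fold_rev_fold[OF assms(1)] fold_in[OF assms(1)]) (auto simp: in_lists_conv_set)
  ultimately show "fold act w x = fold act w' x" by simp
next
  assume "fold act w x = fold act w' x"
  then show "fold act (w @ rev w') x = x" using fold_rev_fold[OF assms(1,3,4)] by simp
qed

lemma orbit_refl [simp]: "x \<in> orbit act \<alpha> x"
  unfolding orbit_def by (rule image_eqI[of _ _ "[]"]) auto

lemma orbit_trans: "y \<in> orbit act \<alpha> x \<Longrightarrow> z \<in> orbit act \<alpha> y \<Longrightarrow> z \<in> orbit act \<alpha> x"
  unfolding orbit_def
proof clarsimp
  fix w w' assume "\<forall>x\<in>set w. x \<in> \<alpha>" "\<forall>x\<in>set w'. x \<in> \<alpha>"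
  then show "fold act w' (fold act w x) \<in> (\<lambda>w. fold act w x) ` lists \<alpha>"
    by (intro image_eqI[of _ _ "w @ w'"]) auto
qed

lemma orbit_step: "y \<in> orbit act \<alpha> x \<Longrightarrow> e \<in> \<alpha> \<Longrightarrow> act e y \<in> orbit act \<alpha> x"
  by (erule orbit_trans) (auto simp: orbit_def intro!: image_eqI[of _ _ "[e]"])

lemma orbit_mono: "\<alpha> \<subseteq> \<beta> \<Longrightarrow> orbit act \<alpha> x \<subseteq> orbit act \<beta> x"
  unfolding orbit_def using lists_mono by blast

lemma orbit_sym:
  assumes "involutions_on X \<alpha> act" "x \<in> X" "y \<in> orbit act \<alpha> x"
  shows "x \<in> orbit act \<alpha> y"
proof -
  obtain w where w: "w \<in> lists \<alpha>" "y = fold act w x" using assms(3) by (auto simp: orbit_def)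
  have "fold act (rev w) y = x" using fold_rev_fold[OF assms(1) w(1) assms(2)] w by simp
  moreover have "rev w \<in> lists \<alpha>" using w by (auto simp: in_lists_conv_set)
  ultimately show ?thesis unfolding orbit_def by force
qed

lemma orbit_subset:
  assumes "involutions_on X \<alpha> act" "x \<in> X"
  shows "orbit act \<alpha> x \<subseteq> X"
  using fold_in[OF assms(1) _ assms(2)] by (auto simp: orbit_def)

lemma orbit_eq:
  assumes "involutions_on X \<alpha> act" "x \<in> X" "y \<in> orbit act \<alpha> x"
  shows "orbit act \<alpha> y = orbit act \<alpha> x"
  using orbit_trans[OF assms(3)] orbit_trans[OF orbit_sym[OF assms]] by blast

section \<open>The group of words\<close>

locale generators =
  fixes E :: "'e set" and N m0 :: nat
  assumes finite_E: "finite E"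
begin

definition actions :: "nat \<Rightarrow> ('e \<Rightarrow> nat \<Rightarrow> nat) set" where
  "actions m = E \<rightarrow>\<^sub>E ({..<m} \<rightarrow>\<^sub>E {..<m})"

definition index_bound :: "nat \<Rightarrow> nat" where
  "index_bound m = card (Pow (actions m \<times> {..<m} \<times> {..<m}))"

text \<open>
  There are at most \<open>index_bound m\<close> ways in which a word can act through involutions of \<open>m\<close> points,
  so \<open>bound (Suc k)\<close> leaves room for \<open>N\<close> cosets of subgroups with at most \<open>k\<close> generators.
\<close>

primrec bound :: "nat \<Rightarrow> nat" where
  "bound 0 = m0"
| "bound (Suc k) = bound k + N * index_bound (bound k)"

lemma finite_actions: "finite (actions m)"
  unfolding actions_def by (intro finite_PiE finite_E) auto

lemma bound_mono: "k \<le> l \<Longrightarrow> bound k \<le> bound l"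
  by (rule lift_Suc_mono_le[of bound]) auto

lemma index_le_bound: "k < l \<Longrightarrow> N * index_bound (bound k) \<le> bound l"
  using bound_mono[of "Suc k" l] by simp

text \<open>
  The relators in \<open>\<alpha>\<close> are tested on \<^emph>\<open>all\<close> involutive actions of bounded size that respect the relators
  in proper subsets of \<open>\<alpha>\<close>. Hence enlarging \<open>\<alpha>\<close> creates no new relators in a smaller set of generators.
\<close>

function relators :: "'e set \<Rightarrow> 'e list set" where
  "relators \<alpha> = {w \<in> lists \<alpha>. \<forall>act :: 'e \<Rightarrow> nat \<Rightarrow> nat.
     (\<forall>e\<in>\<alpha>. act e \<circ> act e = id \<and> (\<forall>n\<ge>bound (card \<alpha>). act e n = n)) \<and>
     (\<forall>\<beta>. \<beta> \<subset> \<alpha> \<and> finite \<alpha> \<longrightarrow> (\<forall>u\<in>relators \<beta>. fold act u = id)) \<longrightarrow>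
     fold act w = id}"
  by pat_completeness auto
termination
  by (relation "measure card") (auto intro: psubset_card_mono)

declare relators.simps [simp del]

definition admissible :: "'e set \<Rightarrow> ('e \<Rightarrow> nat \<Rightarrow> nat) \<Rightarrow> bool" where
  "admissible \<alpha> act \<longleftrightarrow>
     (\<forall>e\<in>\<alpha>. act e \<circ> act e = id \<and> (\<forall>n\<ge>bound (card \<alpha>). act e n = n)) \<and>
     (\<forall>\<beta>. \<beta> \<subset> \<alpha> \<longrightarrow> (\<forall>u\<in>relators \<beta>. fold act u = id))"

lemma relators_iff:
  assumes "\<alpha> \<subseteq> E"
  shows "w \<in> relators \<alpha> \<longleftrightarrow> w \<in> lists \<alpha> \<and> (\<forall>act. admissible \<alpha> act \<longrightarrow> fold act w = id)"
  using finite_subset[OF assms finite_E] by (subst relators.simps) (simp add: admissible_def)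

lemma relators_lists: "\<alpha> \<subseteq> E \<Longrightarrow> w \<in> relators \<alpha> \<Longrightarrow> w \<in> lists \<alpha>"
  by (simp add: relators_iff)

lemma relators_mono:
  assumes "\<alpha> \<subseteq> E" "\<beta> \<subseteq> \<alpha>"
  shows "relators \<beta> \<subseteq> relators \<alpha>"
proof (cases "\<beta> = \<alpha>")
  case False
  show ?thesis
  proof
    fix w assume w: "w \<in> relators \<beta>"
    then have "w \<in> lists \<alpha>" using relators_lists[of \<beta> w] assms by blast
    moreover have "fold act w = id" if "admissible \<alpha> act" for act
      using that False assms(2) w unfolding admissible_def by (meson psubsetI)
    ultimately show "w \<in> relators \<alpha>" by (simp add: relators_iff[OF assms(1)])
  qed
qed auto

lemma fold_delete: "fold (\<lambda>e. if e \<in> \<beta> then act e else id) w = fold act (filter (\<lambda>e. e \<in> \<beta>) w)"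
  by (induction w) auto

text \<open>
  An action of \<open>\<beta>\<close> extends by trivial generators to \<open>\<alpha>\<close>, so deleting generators is a homomorphism.
  It implies that \<open>\<beta>\<close>-orbits and \<open>\<gamma>\<close>-orbits in a free action intersect in \<open>(\<beta> \<inter> \<gamma>)\<close>-orbits.
\<close>

lemma filter_relators:
  assumes "\<alpha> \<subseteq> E" "\<beta> \<subseteq> \<alpha>" "w \<in> relators \<alpha>"
  shows "filter (\<lambda>e. e \<in> \<beta>) w \<in> relators \<beta>"
  using assms
proof (induction "card \<alpha>" arbitrary: \<alpha> \<beta> w rule: less_induct)
  case less
  note fin = finite_subset[OF less.prems(1) finite_E]
  have \<beta>E: "\<beta> \<subseteq> E" using less.prems by blast
  have "fold act (filter (\<lambda>e. e \<in> \<beta>) w) = id" if adm: "admissible \<beta> act" for act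
  proof -
    let ?act = "\<lambda>e. if e \<in> \<beta> then act e else id"
    have "admissible \<alpha> ?act"
      unfolding admissible_def
    proof (intro conjI ballI allI impI)
      fix e assume "e \<in> \<alpha>"
      show "?act e \<circ> ?act e = id" using adm by (auto simp: admissible_def)
      fix n assume "bound (card \<alpha>) \<le> n"
      moreover have "bound (card \<beta>) \<le> bound (card \<alpha>)"
        using bound_mono card_mono[OF fin less.prems(2)] by blast
      ultimately show "?act e n = n" using adm by (auto simp: admissible_def)
    next
      fix \<gamma> u assume \<gamma>: "\<gamma> \<subset> \<alpha>" and u: "u \<in> relators \<gamma>"
      have "card \<gamma> < card \<alpha>" using \<gamma> fin by (simp add: psubset_card_mono)
      then have "filter (\<lambda>e. e \<in> \<beta> \<inter> \<gamma>) u \<in> relators (\<beta> \<inter> \<gamma>)"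
        using less.hyps[of \<gamma> "\<beta> \<inter> \<gamma>" u] \<gamma> u less.prems by blast
      moreover have "filter (\<lambda>e. e \<in> \<beta> \<inter> \<gamma>) u = filter (\<lambda>e. e \<in> \<beta>) u"
        using relators_lists[of \<gamma> u] \<gamma> u less.prems by (intro filter_cong) auto
      ultimately have *: "filter (\<lambda>e. e \<in> \<beta>) u \<in> relators (\<beta> \<inter> \<gamma>)" by simp
      have "fold act (filter (\<lambda>e. e \<in> \<beta>) u) = id"
      proof (cases "\<beta> \<inter> \<gamma> = \<beta>")
        case True
        then show ?thesis using * adm relators_iff[OF \<beta>E] by simp
      next
        case False
        then have "\<beta> \<inter> \<gamma> \<subset> \<beta>" by blast
        then show ?thesis using * adm by (auto simp: admissible_def)
      qed
      then show "fold ?act u = id" by (simp add: fold_delete)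
    qed
    then have "fold ?act w = id" using less.prems relators_iff[OF less.prems(1)] by blast
    then show ?thesis by (simp add: fold_delete)
  qed
  then show ?case using relators_iff[OF \<beta>E] by auto
qed

lemma relators_fold:
  assumes "\<alpha> \<subseteq> E" "w \<in> relators \<alpha>" "finite V" "card V \<le> bound (card \<alpha>)"
    and inv: "involutions_on V \<alpha> act"
    and smaller: "\<And>\<beta> u x. \<beta> \<subset> \<alpha> \<Longrightarrow> u \<in> relators \<beta> \<Longrightarrow> x \<in> V \<Longrightarrow> fold act u x = x"
    and "x \<in> V"
  shows "fold act w x = x"
proof -
  obtain h where h: "bij_betw h V {..<card V}"
    using ex_bij_betw_finite_nat[OF assms(3)] by (auto simp: atLeast0LessThan)
  define g where "g = inv_into V h"
  have gh: "g (h y) = y" if "y \<in> V" for y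
    unfolding g_def by (rule inv_into_f_f[OF bij_betw_imp_inj_on[OF h] that])
  have hg: "h (g k) = k" "g k \<in> V" if "k < card V" for k
    unfolding g_def using h that by (auto simp: bij_betw_def intro!: f_inv_into_f inv_into_into)
  have hlt: "h y < card V" if "y \<in> V" for y using h that by (auto simp: bij_betw_def)
  define act' where "act' e k = (if k < card V then h (act e (g k)) else k)" for e k
  have conj: "fold act' u k = (if k < card V then h (fold act u (g k)) else k)" if "u \<in> lists \<alpha>" for u k
    using that
  proof (induction u arbitrary: k)
    case (Cons e u)
    show ?case
    proof (cases "k < card V")
      case True
      then have "act e (g k) \<in> V" using inv hg Cons by (auto simp: involutions_on_def)
      then show ?thesis using Cons True by (simp add: act'_def hlt gh)
    qed (use Cons in \<open>simp add: act'_def\<close>)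
  qed (use hg in simp)
  have conj_id: "fold act' u = id" if "u \<in> lists \<alpha>" "\<And>x. x \<in> V \<Longrightarrow> fold act u x = x" for u
    using that conj[OF that(1)] hg by auto
  have "admissible \<alpha> act'"
    unfolding admissible_def
  proof (intro conjI ballI allI impI)
    fix e assume "e \<in> \<alpha>"
    then have *: "act e (g k) \<in> V" "act e (act e (g k)) = g k" if "k < card V" for k
      using inv hg that by (auto simp: involutions_on_def)
    show "act' e \<circ> act' e = id" using * by (auto simp: act'_def hlt gh hg)
    fix k assume "bound (card \<alpha>) \<le> k"
    then show "act' e k = k" using assms(4) by (auto simp: act'_def)
  next
    fix \<beta> u assume "\<beta> \<subset> \<alpha>" "u \<in> relators \<beta>"
    then show "fold act' u = id" using smaller relators_lists[of \<beta> u] assms(1)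
      by (intro conj_id) blast+
  qed
  then have "fold act' w = id" using assms(2) relators_iff[OF assms(1)] by blast
  then have "h (fold act w x) = h x"
    using conj[of w "h x"] relators_lists[OF assms(1,2)] assms(7) hlt gh by (metis id_apply)
  moreover have "fold act w x \<in> V" using fold_in[OF inv relators_lists[OF assms(1,2)] assms(7)] .
  ultimately show ?thesis using gh assms(7) by metis
qed

lemma relators_fold_small:
  assumes "\<alpha> \<subseteq> E" "w \<in> relators \<alpha>" "finite V" "card V \<le> m0" "involutions_on V E act" "x \<in> V"
  shows "fold act w x = x"
  using assms(1,2,6)
proof (induction "card \<alpha>" arbitrary: \<alpha> w x rule: less_induct)
  case less
  note fin = finite_subset[OF less.prems(1) finite_E]
  show ?case
  proof (rule relators_fold[OF less.prems(1,2) assms(3) _ _ _ less.prems(3)])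
    show "card V \<le> bound (card \<alpha>)" using assms(4) bound_mono[of 0 "card \<alpha>"] by simp
    show "involutions_on V \<alpha> act" using involutions_on_subset assms less.prems by blast
    fix \<beta> u y assume "\<beta> \<subset> \<alpha>" "u \<in> relators \<beta>" "y \<in> V"
    then show "fold act u y = y"
      using less.hyps[OF psubset_card_mono[OF fin]] less.prems(1) by blast
  qed
qed

lemma relators_map:
  assumes "\<rho> ` E \<subseteq> E" "inj_on \<rho> E" "\<alpha> \<subseteq> E" "w \<in> relators \<alpha>"
  shows "map \<rho> w \<in> relators (\<rho> ` \<alpha>)"
  using assms(3,4)
proof (induction "card \<alpha>" arbitrary: \<alpha> w rule: less_induct)
  case less
  note fin = finite_subset[OF less.prems(1) finite_E]
  have \<rho>E: "\<rho> ` \<alpha> \<subseteq> E" using assms less.prems by blast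
  have inj: "inj_on \<rho> \<alpha>" using assms(2) less.prems inj_on_subset by blast
  have "fold act (map \<rho> w) = id" if adm: "admissible (\<rho> ` \<alpha>) act" for act
  proof -
    have "admissible \<alpha> (act \<circ> \<rho>)"
      unfolding admissible_def
    proof (intro conjI ballI allI impI)
      fix \<beta> u assume \<beta>: "\<beta> \<subset> \<alpha>" "u \<in> relators \<beta>"
      then have "map \<rho> u \<in> relators (\<rho> ` \<beta>)"
        using less.hyps[OF psubset_card_mono[OF fin]] less.prems(1) by blast
      moreover have "\<rho> ` \<beta> \<subset> \<rho> ` \<alpha>" by (rule image_strict_mono[OF inj \<beta>(1)])
      ultimately have "fold act (map \<rho> u) = id" using adm unfolding admissible_def by blast
      then show "fold (act \<circ> \<rho>) u = id" by (simp add: fold_map)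
    qed (use adm card_image[OF inj] in \<open>simp_all add: admissible_def\<close>)
    then show ?thesis using less.prems(2) relators_iff[OF less.prems(1)] by (simp add: fold_map)
  qed
  then show ?case using relators_iff[OF \<rho>E] relators_lists[OF less.prems] by auto
qed

end

section \<open>Coset acyclicity\<close>

locale free_action = generators E N m0 for E :: "'e set" and N m0 +
  fixes X :: "'x set" and act :: "'e \<Rightarrow> 'x \<Rightarrow> 'x"
  assumes involutions: "involutions_on X E act"
    and free: "w \<in> lists E \<Longrightarrow> x \<in> X \<Longrightarrow> fold act w x = x \<longleftrightarrow> w \<in> relators E"
begin

lemma involutions_sub: "\<alpha> \<subseteq> E \<Longrightarrow> involutions_on X \<alpha> act"
  using involutions involutions_on_subset by blast

lemma fold_eq_iff:
  assumes "w \<in> lists E" "w' \<in> lists E" "x \<in> X"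
  shows "fold act w x = fold act w' x \<longleftrightarrow> w @ rev w' \<in> relators E"
proof -
  have "w @ rev w' \<in> lists E" using assms by (auto simp: in_lists_conv_set)
  then show ?thesis using fold_append_rev[OF involutions assms] free assms(3) by blast
qed

lemma orbit_Int:
  assumes "x \<in> X" "\<beta> \<subseteq> E" "\<gamma> \<subseteq> E"
  shows "orbit act \<beta> x \<inter> orbit act \<gamma> x = orbit act (\<beta> \<inter> \<gamma>) x"
proof (rule antisym)
  show "orbit act \<beta> x \<inter> orbit act \<gamma> x \<subseteq> orbit act (\<beta> \<inter> \<gamma>) x"
  proof
    fix y assume "y \<in> orbit act \<beta> x \<inter> orbit act \<gamma> x"
    then obtain w w' where w: "w \<in> lists \<beta>" "w' \<in> lists \<gamma>" "y = fold act w x" "y = fold act w' x"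
      unfolding orbit_def by blast
    define u where "u = filter (\<lambda>e. e \<in> \<beta>) w'"
    have u: "u \<in> lists (\<beta> \<inter> \<gamma>)" using w by (auto simp: u_def)
    have E: "w \<in> lists E" "w' \<in> lists E" "u \<in> lists E" using w u assms by auto
    have "w @ rev w' \<in> relators E" using fold_eq_iff[OF E(1,2) assms(1)] w by simp
    then have "filter (\<lambda>e. e \<in> \<beta>) (w @ rev w') \<in> relators \<beta>"
      using filter_relators[OF order_refl assms(2)] by blast
    moreover have "filter (\<lambda>e. e \<in> \<beta>) (w @ rev w') = w @ rev u"
      using w(1) by (simp add: u_def rev_filter filter_id_conv in_lists_conv_set)
    ultimately have "w @ rev u \<in> relators E" using relators_mono[OF order_refl assms(2)] by auto
    then have "y = fold act u x" using fold_eq_iff[OF E(1,3) assms(1)] w by simp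
    then show "y \<in> orbit act (\<beta> \<inter> \<gamma>) x" using u by (auto simp: orbit_def)
  qed
qed (auto dest: subsetD[OF orbit_mono, rotated])

lemma orbit_INT:
  assumes "finite I" "I \<noteq> {}" "x \<in> X" "\<And>i. i \<in> I \<Longrightarrow> \<alpha> i \<subseteq> E" "\<And>i. i \<in> I \<Longrightarrow> y \<in> orbit act (\<alpha> i) x"
  shows "y \<in> orbit act (\<Inter>i\<in>I. \<alpha> i) x"
  using assms(1,2,4,5)
proof (induction I rule: finite_ne_induct)
  case (insert i I)
  then have "(\<Inter>i\<in>I. \<alpha> i) \<subseteq> E" by blast
  then show ?case using orbit_Int[OF assms(3), of "\<alpha> i" "\<Inter>i\<in>I. \<alpha> i"] insert by auto
qed auto

lemma card_orbit:
  assumes "\<beta> \<subseteq> E" "x \<in> X"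
  shows "finite (orbit act \<beta> x)" "card (orbit act \<beta> x) \<le> index_bound (bound (card \<beta>))"
proof -
  define m where "m = bound (card \<beta>)"
  define ext where "ext a e k = (if k < m then a e k else k)" for a :: "'e \<Rightarrow> nat \<Rightarrow> nat" and e k
  define code where
    "code w = (\<lambda>(a, k). (a, k, fold (ext a) w k)) ` (actions m \<times> {..<m})" for w
  have lt: "fold (ext a) w k < m" if "a \<in> actions m" "w \<in> lists E" "k < m" for a w k
    using that(2,3)
    by (induction w arbitrary: k) (use that(1) in \<open>auto simp: ext_def actions_def PiE_iff\<close>)
  have code_Pow: "code w \<in> Pow (actions m \<times> {..<m} \<times> {..<m})" if "w \<in> lists E" for w
    using lt[OF _ that] by (auto simp: code_def)
  have code_inj: "fold act w x = fold act w' x"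
    if w: "w \<in> lists \<beta>" "w' \<in> lists \<beta>" and eq: "code w = code w'" for w w'
  proof -
    have "fold b (w @ rev w') = id" if adm: "admissible \<beta> b" for b
    proof
      fix k
      have b: "involutions_on UNIV \<beta> b"
        using adm by (auto simp: admissible_def involutions_on_def o_def id_def fun_eq_iff)
      have b_lt: "b e k < m" if "e \<in> \<beta>" "k < m" for e k
      proof (rule ccontr)
        assume "\<not> b e k < m"
        then have "b e (b e k) = b e k" using adm that by (auto simp: admissible_def m_def)
        then show False using b that \<open>\<not> b e k < m\<close> by (auto simp: involutions_on_def)
      qed
      define a where "a = (\<lambda>e\<in>E. \<lambda>k\<in>{..<m}. if e \<in> \<beta> then b e k else k)"
      have a: "a \<in> actions m" using b_lt by (auto simp: a_def actions_def)
      have same: "fold b u k = fold (ext a) u k" if "u \<in> lists \<beta>" for u k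
        using that
      proof (induction u arbitrary: k)
        case (Cons e u)
        then have "b e k = ext a e k"
          using adm assms(1) by (auto simp: ext_def a_def admissible_def m_def)
        then show ?case using Cons by simp
      qed simp
      have "fold b w k = fold b w' k"
      proof (cases "k < m")
        case True
        then have "(a, k, fold (ext a) w k) \<in> code w'" using a eq[symmetric] by (force simp: code_def)
        then have "fold (ext a) w k = fold (ext a) w' k" by (auto simp: code_def)
        then show ?thesis using same w by simp
      next
        case False
        have "fold (ext a) u k = k" for u using False by (induction u) (auto simp: ext_def)
        then show ?thesis using same w by simp
      qed
      then show "fold b (w @ rev w') k = id k" by (simp only: id_apply fold_append_rev[OF b w UNIV_I])
    qed
    then have "w @ rev w' \<in> relators \<beta>" using w relators_iff[OF assms(1)] by auto
    then show ?thesis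
      using fold_eq_iff[OF _ _ assms(2)] w assms(1) relators_mono[OF order_refl assms(1)] by blast
  qed
  have "\<forall>y\<in>orbit act \<beta> x. \<exists>w. w \<in> lists \<beta> \<and> fold act w x = y" by (auto simp: orbit_def)
  from bchoice[OF this]
  obtain word where word: "\<And>y. y \<in> orbit act \<beta> x \<Longrightarrow> word y \<in> lists \<beta> \<and> fold act (word y) x = y"
    by blast
  have inj: "inj_on (\<lambda>y. code (word y)) (orbit act \<beta> x)"
  proof (rule inj_onI)
    fix y z assume "y \<in> orbit act \<beta> x" "z \<in> orbit act \<beta> x" "code (word y) = code (word z)"
    then show "y = z" using code_inj[of "word y" "word z"] word[of y] word[of z] by simp
  qed
  have sub: "(\<lambda>y. code (word y)) ` orbit act \<beta> x \<subseteq> Pow (actions m \<times> {..<m} \<times> {..<m})"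
    using code_Pow word assms(1) by blast
  have fin: "finite (Pow (actions m \<times> {..<m} \<times> {..<m}))" using finite_actions by blast
  show "finite (orbit act \<beta> x)" using inj_on_finite[OF inj sub fin] .
  show "card (orbit act \<beta> x) \<le> index_bound (bound (card \<beta>))"
    using card_inj_on_le[OF inj sub fin] by (simp add: index_bound_def m_def)
qed

end

locale coset_chain = free_action E N m0 X act
  for E :: "'e set" and N m0 and X :: "'x set" and act +
  fixes n :: nat and a :: "nat \<Rightarrow> 'e set" and x :: "nat \<Rightarrow> 'x"
  assumes n_le: "n \<le> N"
    and a_sub: "i < n \<Longrightarrow> a i \<subseteq> E"
    and x_in: "i < n \<Longrightarrow> x i \<in> X"
    and no_triple: "Suc (Suc i) < n \<Longrightarrow>
      orbit act (a i) (x i) \<inter> orbit act (a (Suc i)) (x (Suc i)) \<inter>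
      orbit act (a (Suc (Suc i))) (x (Suc (Suc i))) = {}"
begin

definition C :: "nat \<Rightarrow> 'x set" where
  "C i = orbit act (a i) (x i)"

text \<open>
  The parts \<open>C i\<close> are glued along the intersections of consecutive ones: \<open>norm i y\<close> is the point
  of the amalgam given by \<open>y \<in> C i\<close>, and \<open>(i, y)\<close> is its own normal form unless \<open>y \<in> C (i - 1)\<close>.
  A generator without an edge at a point of the amalgam fixes that point.
\<close>

definition norm :: "nat \<Rightarrow> 'x \<Rightarrow> nat \<times> 'x" where
  "norm i y = (if i > 0 \<and> y \<in> C (i - 1) then (i - 1, y) else (i, y))"

definition V :: "(nat \<times> 'x) set" where
  "V = {(i, y). i < n \<and> y \<in> C i \<and> (i > 0 \<longrightarrow> y \<notin> C (i - 1))}"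

definition step :: "'e \<Rightarrow> nat \<times> 'x \<Rightarrow> nat \<times> 'x" where
  "step e = (\<lambda>(i, y).
     if e \<in> a i then norm i (act e y)
     else if Suc i < n \<and> y \<in> C (Suc i) \<and> e \<in> a (Suc i) then norm (Suc i) (act e y)
     else (i, y))"

lemma C_sub: "i < n \<Longrightarrow> C i \<subseteq> X"
  unfolding C_def using orbit_subset[OF involutions_sub[OF a_sub] x_in] .

lemma C_step: "y \<in> C i \<Longrightarrow> e \<in> a i \<Longrightarrow> act e y \<in> C i"
  unfolding C_def by (rule orbit_step)

lemma C_orbit: "i < n \<Longrightarrow> y \<in> C i \<Longrightarrow> orbit act (a i) y = C i"
  unfolding C_def using orbit_eq[OF involutions_sub[OF a_sub] x_in] .

lemma no_triple_C: "Suc 0 < i \<Longrightarrow> i < n \<Longrightarrow> y \<in> C i \<Longrightarrow> y \<in> C (i - 1) \<Longrightarrow> y \<notin> C (i - Suc (Suc 0))"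
  using no_triple[of "i - 2"] by (auto simp: C_def Suc_diff_Suc numeral_2_eq_2)

lemma norm_in_V: "i < n \<Longrightarrow> y \<in> C i \<Longrightarrow> norm i y \<in> V"
  using no_triple_C[of i y] by (auto simp: norm_def V_def)

lemma norm_V: "(i, y) \<in> V \<Longrightarrow> norm i y = (i, y)"
  by (auto simp: norm_def V_def)

lemma snd_norm [simp]: "snd (norm i y) = y"
  by (simp add: norm_def)

lemma act_act: "i < n \<Longrightarrow> y \<in> C i \<Longrightarrow> e \<in> E \<Longrightarrow> act e (act e y) = y"
  using involutions C_sub by (auto simp: involutions_on_def)

lemma step_norm:
  assumes "i < n" "y \<in> C i" "e \<in> a i"
  shows "step e (norm i y) = norm i (act e y)"
proof (cases "i > 0 \<and> y \<in> C (i - 1)")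
  case True
  show ?thesis
  proof (cases "e \<in> a (i - 1)")
    case e: True
    have "act e y \<in> C i" "act e y \<in> C (i - 1)" using C_step assms e True by auto
    then show ?thesis using True e no_triple_C[of i "act e y"] assms by (auto simp: norm_def step_def)
  qed (use True assms in \<open>auto simp: norm_def step_def\<close>)
qed (use assms in \<open>auto simp: norm_def step_def\<close>)

lemma fold_step_norm:
  assumes "i < n" "y \<in> C i" "w \<in> lists (a i)"
  shows "fold step w (norm i y) = norm i (fold act w y)"
  using assms(3,2) by (induction w arbitrary: y) (use assms(1) in \<open>auto simp: step_norm C_step\<close>)

lemma V_cases:
  assumes "v \<in> V"
  obtains (move) i y where "i < n" "y \<in> C i" "v = norm i y" "e \<in> a i"
  | (stay) "step e v = v"
proof -
  obtain i y where v: "v = (i, y)" "i < n" "y \<in> C i" using assms by (auto simp: V_def)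
  consider "e \<in> a i" | "Suc i < n" "y \<in> C (Suc i)" "e \<in> a (Suc i)"
    | "e \<notin> a i" "\<not> (Suc i < n \<and> y \<in> C (Suc i) \<and> e \<in> a (Suc i))" by blast
  then show ?thesis
  proof cases
    case 1 then show ?thesis using v norm_V assms by (intro move[of i y]) auto
  next
    case 2 then show ?thesis using v by (intro move[of "Suc i" y]) (auto simp: norm_def)
  next
    case 3 then show ?thesis using v by (intro stay) (auto simp: step_def)
  qed
qed

lemma involutions_step: "involutions_on V E step"
  unfolding involutions_on_def
proof (intro ballI)
  fix e v assume e: "e \<in> E" and v: "v \<in> V"
  show "step e v \<in> V \<and> step e (step e v) = v"
    using v
  proof (cases rule: V_cases[where e = e])
    case (move i y)
    then show ?thesis using step_norm C_step act_act e norm_in_V by simp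
  qed (use v in simp)
qed

lemma snd_fold_step:
  assumes "\<gamma> \<subseteq> E" "w \<in> lists \<gamma>" "v \<in> V"
  shows "snd (fold step w v) \<in> orbit act \<gamma> (snd v)"
  using assms(2,3)
proof (induction w arbitrary: v)
  case (Cons e w)
  then have e: "e \<in> \<gamma>" "e \<in> E" using assms by auto
  have "snd (step e v) \<in> orbit act \<gamma> (snd v)"
    using \<open>v \<in> V\<close>
  proof (cases rule: V_cases[where e = e])
    case (move i y)
    then show ?thesis using step_norm orbit_step[OF orbit_refl e(1)] by simp
  qed simp
  moreover have "step e v \<in> V" using involutions_step Cons e by (auto simp: involutions_on_def)
  ultimately show ?case using Cons orbit_trans by fastforce
qed simp

text \<open>
  Points of one part \<open>j\<close> in the same \<open>\<gamma>\<close>-orbit of the amalgam lie in the same \<open>\<gamma>\<close>-orbit and in the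
  same \<open>a j\<close>-orbit of \<open>X\<close>, hence in one \<open>(\<gamma> \<inter> a j)\<close>-orbit.
\<close>

lemma card_orbit_step:
  assumes \<gamma>: "\<gamma> \<subseteq> E" and v: "v \<in> V"
    and proper: "\<And>i y. (i, y) \<in> orbit step \<gamma> v \<Longrightarrow> \<not> \<gamma> \<subseteq> a i"
  shows "finite (orbit step \<gamma> v)" "card (orbit step \<gamma> v) \<le> bound (card \<gamma>)"
proof -
  define K where "K = orbit step \<gamma> v"
  define K' where "K' j = {y. (j, y) \<in> K}" for j
  have inv: "involutions_on V \<gamma> step" using involutions_step involutions_on_subset \<gamma> by blast
  have KV: "K \<subseteq> V" unfolding K_def using orbit_subset[OF inv v] .
  have fin\<gamma>: "finite \<gamma>" using finite_subset[OF \<gamma> finite_E] .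
  have K': "finite (K' j) \<and> N * card (K' j) \<le> bound (card \<gamma>)" if j: "j < n" for j
  proof (cases "K' j = {}")
    case False
    then obtain y where y: "(j, y) \<in> K" by (auto simp: K'_def)
    then have yj: "y \<in> C j" "(j, y) \<in> V" using KV by (auto simp: V_def)
    then have yX: "y \<in> X" using C_sub j by blast
    define \<beta> where "\<beta> = \<gamma> \<inter> a j"
    have \<beta>: "\<beta> \<subset> \<gamma>" using proper y by (auto simp: \<beta>_def K_def)
    then have \<beta>E: "\<beta> \<subseteq> E" using \<gamma> by blast
    have "K' j \<subseteq> orbit act \<beta> y"
    proof
      fix z assume "z \<in> K' j"
      then have z: "(j, z) \<in> K" by (simp add: K'_def)
      then have "z \<in> C j" using KV by (auto simp: V_def)
      then have "z \<in> orbit act (a j) y" using C_orbit j yj by simp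
      moreover have "(j, z) \<in> orbit step \<gamma> (j, y)"
        using z y orbit_eq[OF inv v, of "(j, y)"] by (simp add: K_def)
      then obtain w where w: "w \<in> lists \<gamma>" "(j, z) = fold step w (j, y)"
        unfolding orbit_def by (elim imageE)
      then have "z \<in> orbit act \<gamma> y" using snd_fold_step[OF \<gamma> w(1) yj(2)] by (simp flip: w(2))
      ultimately show "z \<in> orbit act \<beta> y" using orbit_Int[OF yX \<gamma> a_sub[OF j]] by (auto simp: \<beta>_def)
    qed
    then have "finite (K' j)" "card (K' j) \<le> index_bound (bound (card \<beta>))"
      using card_orbit[OF \<beta>E yX] by (blast intro: finite_subset card_mono le_trans)+
    moreover have "N * index_bound (bound (card \<beta>)) \<le> bound (card \<gamma>)"
      by (rule index_le_bound) (rule psubset_card_mono[OF fin\<gamma> \<beta>])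
    ultimately show ?thesis using mult_le_mono2[of "card (K' j)" _ N] le_trans by blast
  qed simp
  have K: "K = (\<Union>j<n. Pair j ` K' j)" using KV by (auto simp: K'_def V_def)
  show "finite (orbit step \<gamma> v)" unfolding K_def[symmetric] K using K' by blast
  have "card K \<le> (\<Sum>j<n. card (Pair j ` K' j))" unfolding K by (rule card_UN_le) simp
  also have "\<dots> = (\<Sum>j<n. card (K' j))" by (simp add: card_image inj_on_def)
  finally have "N * card K \<le> N * (\<Sum>j<n. card (K' j))" by simp
  also have "\<dots> \<le> (\<Sum>j<n. bound (card \<gamma>))" unfolding sum_distrib_left by (rule sum_mono) (use K' in simp)
  also have "\<dots> \<le> N * bound (card \<gamma>)" using n_le by simp
  finally have "N * card K \<le> N * bound (card \<gamma>)" .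
  moreover have "N > 0" using v n_le by (auto simp: V_def)
  ultimately show "card (orbit step \<gamma> v) \<le> bound (card \<gamma>)" by (simp add: K_def)
qed

lemma relators_fold_step:
  assumes "\<gamma> \<subseteq> E" "u \<in> relators \<gamma>" "v \<in> V"
  shows "fold step u v = v"
  using assms
proof (induction "card \<gamma>" arbitrary: \<gamma> u v rule: less_induct)
  case less
  note \<gamma> = less.prems(1)
  have inv: "involutions_on V \<gamma> step" using involutions_step involutions_on_subset \<gamma> by blast
  show ?case
  proof (cases "\<exists>i y. (i, y) \<in> orbit step \<gamma> v \<and> \<gamma> \<subseteq> a i")
    case True
    then obtain i y where iy: "(i, y) \<in> orbit step \<gamma> v" "\<gamma> \<subseteq> a i" by blast
    then have V: "(i, y) \<in> V" using orbit_subset[OF inv less.prems(3)] by blast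
    then have i: "i < n" "y \<in> C i" by (auto simp: V_def)
    have "v \<in> orbit step \<gamma> (i, y)" using orbit_sym[OF inv less.prems(3) iy(1)] .
    then obtain w where w: "w \<in> lists \<gamma>" "v = fold step w (norm i y)"
      using norm_V[OF V] by (auto simp: orbit_def)
    have wa: "w \<in> lists (a i)" "u \<in> lists (a i)" using w iy relators_lists[OF \<gamma> less.prems(2)] by auto
    define z where "z = fold act w y"
    have z: "z \<in> C i" using C_orbit[OF i] wa by (auto simp: z_def orbit_def)
    have v: "v = norm i z" using fold_step_norm[OF i wa(1)] w by (simp add: z_def)
    have "u \<in> relators E" using relators_mono[OF order_refl \<gamma>] less.prems by blast
    then have "fold act u z = z" using free[of u z] relators_lists[OF order_refl] C_sub[OF i(1)] z by blast
    then show ?thesis using fold_step_norm[OF i(1) z wa(2)] v by simp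
  next
    case False
    have K: "finite (orbit step \<gamma> v)" "card (orbit step \<gamma> v) \<le> bound (card \<gamma>)"
      using card_orbit_step[OF \<gamma> less.prems(3)] False by blast+
    have KV: "orbit step \<gamma> v \<subseteq> V" using orbit_subset[OF inv less.prems(3)] .
    show ?thesis
    proof (rule relators_fold[OF \<gamma> less.prems(2) K])
      show "involutions_on (orbit step \<gamma> v) \<gamma> step"
        using inv KV orbit_step[of _ step \<gamma> v] by (auto simp: involutions_on_def)
      fix \<beta> u' v' assume \<beta>: "\<beta> \<subset> \<gamma>" "u' \<in> relators \<beta>" "v' \<in> orbit step \<gamma> v"
      have "card \<beta> < card \<gamma>" using psubset_card_mono[OF finite_subset[OF \<gamma> finite_E] \<beta>(1)] .
      then show "fold step u' v' = v'" using less.hyps[of \<beta> u' v'] \<beta> KV \<gamma> by blast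
    qed simp
  qed
qed

lemma chain_not_closed:
  assumes n: "n \<ge> 2" and C: "\<And>i. i < n \<Longrightarrow> g i \<in> C i \<and> g (Suc i) \<in> C i"
    and closed: "g n = g 0" and ends: "g 0 \<notin> C (n - 2)"
  shows False
proof -
  have "\<exists>w. w \<in> lists (a i) \<and> g (Suc i) = fold act w (g i)" if "i < n" for i
    using C_orbit[OF that, of "g i"] C[OF that] by (auto simp: orbit_def)
  then obtain w where w: "\<And>i. i < n \<Longrightarrow> w i \<in> lists (a i) \<and> g (Suc i) = fold act (w i) (g i)"
    by metis
  define W where "W k = concat (map w [0..<k])" for k
  have W: "W k \<in> lists E \<and> fold act (W k) (g 0) = g k \<and>
      (k > 0 \<longrightarrow> fold step (W k) (norm 0 (g 0)) = norm (k - 1) (g k))" if "k \<le> n" for k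
    using that
  proof (induction k)
    case (Suc k)
    then have k: "k < n" by simp
    have "norm (k - 1) (g k) = norm k (g k)" if "k > 0"
    proof -
      have "g k \<in> C (k - 1)" "g k \<in> C k" using C[of k] C[of "k - 1"] k that by auto
      then show ?thesis using that k no_triple_C[of k "g k"] by (auto simp: norm_def)
    qed
    then have "fold step (W k) (norm 0 (g 0)) = norm k (g k)" using Suc by (cases k) (auto simp: W_def)
    moreover have "W (Suc k) = W k @ w k" by (simp add: W_def)
    moreover have "fold step (w k) (norm k (g k)) = norm k (g (Suc k))"
      using fold_step_norm[OF k, of "g k" "w k"] C[OF k] w[OF k] by simp
    ultimately show ?case using Suc w[OF k] a_sub[OF k] by auto
  qed (simp add: W_def)
  have "g 0 \<in> X" using C[of 0] C_sub[of 0] n by auto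
  then have "W n \<in> relators E" using W[of n] free[of "W n" "g 0"] closed by simp
  moreover have "norm 0 (g 0) \<in> V" using norm_in_V C[of 0] n by simp
  ultimately have "norm (n - 1) (g 0) = norm 0 (g 0)"
    using relators_fold_step[OF order_refl] W[of n] closed n by simp
  then show False using ends n by (auto simp: norm_def numeral_2_eq_2 split: if_splits)
qed

end

context free_action begin

theorem coset_acyclic:
  assumes n: "3 \<le> n" "n \<le> N" and a: "\<And>i. i < n \<Longrightarrow> a i \<subseteq> E" and x: "\<And>i. i < n \<Longrightarrow> x i \<in> X"
    and C: "\<And>i. i < n \<Longrightarrow> C i = orbit act (a i) (x i)"
    and meet: "\<And>i. i < n \<Longrightarrow> C i \<inter> C (Suc i mod n) \<noteq> {}"
  shows "\<exists>i<n. C i \<inter> C (Suc i mod n) \<inter> C (Suc (Suc i) mod n) \<noteq> {}"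
proof (rule ccontr)
  assume no: "\<not> ?thesis"
  interpret chain: coset_chain E N m0 X act n a x
  proof
    fix i assume i: "Suc (Suc i) < n"
    then have "C i \<inter> C (Suc i mod n) \<inter> C (Suc (Suc i) mod n) = {}" using no by (meson Suc_lessD)
    then show "orbit act (a i) (x i) \<inter> orbit act (a (Suc i)) (x (Suc i)) \<inter>
        orbit act (a (Suc (Suc i))) (x (Suc (Suc i))) = {}"
      using i C[of i] C[of "Suc i"] C[of "Suc (Suc i)"] by simp
  qed (use n a x in auto)
  have CC: "chain.C i = C i" if "i < n" for i using C that by (simp add: chain.C_def)
  have "\<forall>i. \<exists>y. i < n \<longrightarrow> y \<in> C i \<inter> C (Suc i mod n)" using meet by blast
  then obtain y where y: "\<And>i. i < n \<Longrightarrow> y i \<in> C i \<inter> C (Suc i mod n)" by metis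
  define g where "g i = (if i = 0 then y (n - 1) else y (i - 1))" for i
  show False
  proof (rule chain.chain_not_closed[of g])
    fix i assume i: "i < n"
    have "g i \<in> C i"
    proof (cases "i = 0")
      case True then show ?thesis using y[of "n - 1"] n by (simp add: g_def)
    next
      case False then show ?thesis using y[of "i - 1"] i by (simp add: g_def)
    qed
    moreover have "g (Suc i) \<in> C i" using y[OF i] by (simp add: g_def)
    ultimately show "g i \<in> chain.C i \<and> g (Suc i) \<in> chain.C i" using CC i by simp
  next
    obtain m where m: "n = Suc (Suc (Suc m))" using n by (metis add.commute add_Suc_right le_Suc_ex numeral_3_eq_3 plus_nat.add_0)
    have "C (Suc m) \<inter> C (Suc (Suc m)) \<inter> C 0 = {}" using no[simplified, rule_format, of "Suc m"] m by simp
    then show "g 0 \<notin> chain.C (n - 2)" using y[of "Suc (Suc m)"] m CC[of "Suc m"] by (auto simp: g_def)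
  qed (use n in \<open>auto simp: g_def\<close>)
qed

end

section \<open>The covering by orbits\<close>

definition pairs_at :: "'b set set \<Rightarrow> 'b \<Rightarrow> ('b set \<times> 'b set) set" where
  "pairs_at S b = {(s, s'). s \<in> S \<and> s' \<in> S \<and> b \<in> s \<and> b \<in> s'}"

lemma pairs_at_sub: "pairs_at S b \<subseteq> S \<times> S"
  by (auto simp: pairs_at_def)

locale orbit_cover = free_action "S \<times> S" N m0 X act
  for S :: "'b set set" and N m0 and X :: "'x set" and act +
  fixes B :: "'b set" and col :: "'x \<Rightarrow> 'b set" and vert :: "'b \<Rightarrow> 'x \<Rightarrow> 'a" and p :: "'a \<Rightarrow> 'b"
  assumes N3: "3 \<le> N" and hyper: "hypergraph B S" and finite_X: "finite X"
    and col: "col ` X = S"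
    and col_act: "x \<in> X \<Longrightarrow> e \<in> S \<times> S \<Longrightarrow> col (act e x) = transpose (fst e) (snd e) (col x)"
    and vert_eq_iff: "x \<in> X \<Longrightarrow> y \<in> X \<Longrightarrow> b \<in> col x \<Longrightarrow> c \<in> col y \<Longrightarrow>
      vert b x = vert c y \<longleftrightarrow> b = c \<and> y \<in> orbit act (pairs_at S b) x"
    and p_vert: "x \<in> X \<Longrightarrow> b \<in> col x \<Longrightarrow> p (vert b x) = b"
begin

definition edge :: "'x \<Rightarrow> 'a set" where
  "edge x = (\<lambda>b. vert b x) ` col x"

abbreviation U :: "'a set set" where "U \<equiv> edge ` X"
abbreviation A :: "'a set" where "A \<equiv> \<Union>U"

lemma inv_at: "involutions_on X (pairs_at S b) act"
  by (rule involutions_sub[OF pairs_at_sub])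

lemma act_in: "x \<in> X \<Longrightarrow> e \<in> S \<times> S \<Longrightarrow> act e x \<in> X"
  using involutions by (auto simp: involutions_on_def)

lemma col_S: "x \<in> X \<Longrightarrow> col x \<in> S"
  using col by blast

lemma col_fold:
  assumes "w \<in> lists (pairs_at S b)" "x \<in> X" "b \<in> col x"
  shows "b \<in> col (fold act w x)"
  using assms
proof (induction w arbitrary: x rule: lists.induct)
  case (Cons e w)
  have e: "e \<in> S \<times> S" using Cons.hyps(1) pairs_at_sub[of S b] by blast
  have "b \<in> fst e" "b \<in> snd e" using Cons.hyps(1) by (auto simp: pairs_at_def)
  then have "b \<in> transpose (fst e) (snd e) (col x)" using Cons.prems(2) by (simp add: transpose_def)
  then have "b \<in> col (act e x)" using col_act[OF Cons.prems(1) e] by simp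
  then show ?case using Cons.IH[OF act_in[OF Cons.prems(1) e]] by simp
qed simp

lemma p_edge: "x \<in> X \<Longrightarrow> p ` edge x = col x"
  unfolding edge_def by (force simp: p_vert image_image)

lemma edge_orbit:
  assumes "x \<in> X" "y \<in> X" "a \<in> edge x" "a \<in> edge y"
  shows "y \<in> orbit act (pairs_at S (p a)) x"
  using assms vert_eq_iff p_vert unfolding edge_def by fastforce

lemma orbit_edge:
  assumes "x \<in> X" "a \<in> edge x" "y \<in> orbit act (pairs_at S (p a)) x"
  shows "a \<in> edge y"
proof -
  obtain b where b: "b \<in> col x" "a = vert b x" using assms by (auto simp: edge_def)
  then have pa: "p a = b" using p_vert assms by simp
  have "y \<in> X" using assms(3) orbit_subset[OF inv_at assms(1)] by blast
  moreover have "b \<in> col y" using assms col_fold b pa by (auto simp: orbit_def)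
  ultimately show ?thesis using vert_eq_iff[OF assms(1), of y b b] b assms(3) pa by (auto simp: edge_def)
qed

lemma finite_edge: "x \<in> X \<Longrightarrow> finite (edge x) \<and> edge x \<noteq> {}"
  using hyper col_S by (auto simp: hypergraph_def edge_def)

lemma finite_A: "finite A"
  using finite_X finite_edge by blast

lemma covering: "hypergraph_covering A U B S p"
  unfolding hypergraph_covering_def hypergraph_hom_def
proof (intro conjI ballI impI)
  show "p ` A \<subseteq> B" using p_edge col_S hyper by (fastforce simp: hypergraph_def)
  show "(\<lambda>u. p ` u) ` U = S" using p_edge col by (force simp: image_image)
  fix u assume "u \<in> U"
  then obtain x where x: "x \<in> X" "u = edge x" by blast
  show "inj_on p u" using x p_vert by (auto simp: edge_def inj_on_def)
  show "p ` u \<in> S" using x p_edge col_S by simp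
next
  fix s s' u assume s: "s \<in> S" "s' \<in> S" "s \<inter> s' \<noteq> {}" and u: "u \<in> U" "p ` u = s"
  obtain x where x: "x \<in> X" "u = edge x" using u by blast
  have colx: "col x = s" using u x p_edge by simp
  define y where "y = act (s, s') x"
  have y: "y \<in> X" using act_in x s by (simp add: y_def)
  have coly: "col y = s'" using col_act[OF x(1), of "(s, s')"] s colx by (simp add: y_def)
  have "s \<inter> s' \<subseteq> p ` (u \<inter> edge y)"
  proof
    fix b assume b: "b \<in> s \<inter> s'"
    have "(s, s') \<in> pairs_at S b" using b s by (simp add: pairs_at_def)
    then have "y \<in> orbit act (pairs_at S b) x" unfolding y_def by (rule orbit_step[OF orbit_refl])
    moreover have "vert b x \<in> edge x" "p (vert b x) = b"
      using b colx p_vert x by (auto simp: edge_def)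
    ultimately show "b \<in> p ` (u \<inter> edge y)" using orbit_edge[OF x(1), of "vert b x" y] x by force
  qed
  moreover have "p ` (u \<inter> edge y) \<subseteq> s \<inter> s'" using u(2) p_edge[OF y] coly by blast
  ultimately show "\<exists>u'\<in>U. p ` u' = s' \<and> s \<inter> s' = p ` (u \<inter> u')"
    using y p_edge[OF y] coly by blast
qed

lemma adj_edge: "gaifman_adj U a a' \<longleftrightarrow> a \<noteq> a' \<and> (\<exists>x\<in>X. a \<in> edge x \<and> a' \<in> edge x)"
  by (auto simp: gaifman_adj_def)

lemma no_chordless_cycle:
  assumes "chordless_cycle A U c" "3 < length c" "length c \<le> N"
  shows False
proof -
  define n where "n = length c"
  have n: "3 < n" "n \<le> N" using assms by (auto simp: n_def)
  have dist: "distinct c" and "\<forall>i<n. \<forall>j<n.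
      gaifman_adj U (c ! i) (c ! j) \<longleftrightarrow> j = Suc i mod n \<or> i = Suc j mod n"
    using assms(1) unfolding chordless_cycle_def n_def by blast+
  then have adj: "gaifman_adj U (c ! i) (c ! j) \<longleftrightarrow> j = Suc i mod n \<or> i = Suc j mod n"
    if "i < n" "j < n" for i j using that by blast
  have "\<forall>i\<in>{..<n}. \<exists>x. x \<in> X \<and> c ! i \<in> edge x \<and> c ! (Suc i mod n) \<in> edge x"
  proof
    fix i assume "i \<in> {..<n}"
    then have "gaifman_adj U (c ! i) (c ! (Suc i mod n))" using adj[of i "Suc i mod n"] n by simp
    then show "\<exists>x. x \<in> X \<and> c ! i \<in> edge x \<and> c ! (Suc i mod n) \<in> edge x"
      unfolding adj_edge by blast
  qed
  from bchoice[OF this] obtain y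
    where y: "\<And>i. i < n \<Longrightarrow> y i \<in> X \<and> c ! i \<in> edge (y i) \<and> c ! (Suc i mod n) \<in> edge (y i)"
    by auto
  define C where "C i = orbit act (pairs_at S (p (c ! i))) (y i)" for i
  have "\<exists>i<n. C i \<inter> C (Suc i mod n) \<inter> C (Suc (Suc i) mod n) \<noteq> {}"
  proof (rule coset_acyclic[where a = "\<lambda>i. pairs_at S (p (c ! i))" and x = y])
    fix i assume i: "i < n"
    then have i': "Suc i mod n < n" by simp
    have "y i \<in> C (Suc i mod n)" unfolding C_def using edge_orbit y[OF i] y[OF i'] by blast
    moreover have "y i \<in> C i" by (simp add: C_def)
    ultimately show "C i \<inter> C (Suc i mod n) \<noteq> {}" by blast
  qed (use n y pairs_at_sub in \<open>simp_all add: C_def\<close>)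
  then obtain i z where i: "i < n" and z: "z \<in> C i" "z \<in> C (Suc (Suc i) mod n)" by blast
  define j where "j = Suc (Suc i) mod n"
  have j: "j < n" using n by (simp add: j_def)
  have "z \<in> X" using z(1) orbit_subset[OF inv_at] y[OF i] unfolding C_def by blast
  moreover have "c ! i \<in> edge z" "c ! j \<in> edge z"
    using z orbit_edge y[OF i] y[OF j] unfolding C_def j_def[symmetric] by blast+
  moreover have ij: "i \<noteq> j" "j \<noteq> Suc i mod n" "i \<noteq> Suc j mod n"
    using n i unfolding j_def by (auto simp: mod_Suc)
  moreover have "c ! i \<noteq> c ! j" using dist i j ij by (simp add: nth_eq_iff_index_eq n_def)
  ultimately show False using adj[OF i j] adj_edge by blast
qed

lemma clique_in_edge:
  assumes "finite K" "gaifman_clique A U K"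
  shows "\<exists>x\<in>X. K \<subseteq> edge x"
  using assms
proof (induction "card K" arbitrary: K rule: less_induct)
  case less
  note K = less.prems
  have ne: "K \<noteq> {}" "K \<subseteq> A" and adj: "\<And>a a'. a \<in> K \<Longrightarrow> a' \<in> K \<Longrightarrow> a \<noteq> a' \<Longrightarrow> gaifman_adj U a a'"
    using K(2) by (auto simp: gaifman_clique_def)
  obtain a0 where a0: "a0 \<in> K" using ne by blast
  show ?case
  proof (cases "\<exists>a1\<in>K. \<exists>a2\<in>K. a1 \<noteq> a0 \<and> a2 \<noteq> a0 \<and> a1 \<noteq> a2")
    case False
    show ?thesis
    proof (cases "K = {a0}")
      case True then show ?thesis using ne by auto
    next
      case K': False
      then obtain a1 where a1: "a1 \<in> K" "a1 \<noteq> a0" using a0 by blast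
      then have "K = {a0, a1}" using False a0 by blast
      then show ?thesis using adj[OF a0 a1(1)] a1 adj_edge by auto
    qed
  next
    case True
    then obtain a1 a2 where a12: "a1 \<in> K" "a2 \<in> K" "a1 \<noteq> a0" "a2 \<noteq> a0" "a1 \<noteq> a2" by blast
    define a where "a i = (if i = 0 then a0 else if i = 1 then a1 else a2)" for i :: nat
    have a: "a i \<in> K" for i using a0 a12 by (simp add: a_def)
    have "\<exists>x. x \<in> X \<and> K - {a i} \<subseteq> edge x" for i
    proof -
      have "card (K - {a i}) < card K" using card_Diff1_less[OF K(1) a] .
      moreover have "K - {a i} \<noteq> {}" using a0 a12 by (auto simp: a_def)
      then have "gaifman_clique A U (K - {a i})" using ne adj by (auto simp: gaifman_clique_def)
      ultimately show ?thesis using less.hyps[of "K - {a i}"] K by auto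
    qed
    then obtain x where x: "\<And>i. x i \<in> X \<and> K - {a i} \<subseteq> edge (x i)" by metis
    define L where "L i = K - {a i, a (Suc i mod 3)}" for i
    define \<beta> where "\<beta> i = (\<Inter>c\<in>L i. pairs_at S (p c))" for i
    define C where "C i = orbit act (\<beta> i) (x i)" for i
    have less3: "i = 0 \<or> i = 1 \<or> i = 2" if "i < 3" for i :: nat using that by linarith
    have L: "finite (L i)" "L i \<noteq> {}" if "i < 3" for i
      using K(1) less3[OF that] a0 a12 by (auto simp: L_def a_def)
    have \<beta>E: "\<beta> i \<subseteq> S \<times> S" if "i < 3" for i using L(2)[OF that] pairs_at_sub by (fastforce simp: \<beta>_def)
    have "\<exists>i<3. C i \<inter> C (Suc i mod 3) \<inter> C (Suc (Suc i) mod 3) \<noteq> {}"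
    proof (rule coset_acyclic[where a = \<beta> and x = x])
      fix i :: nat assume i: "i < 3"
      define j where "j = Suc i mod 3"
      have "x j \<in> orbit act (pairs_at S (p c)) (x i)" if "c \<in> L i" for c
        using that x edge_orbit[of "x i" "x j" c] by (auto simp: L_def j_def)
      then have "x j \<in> C i"
        unfolding C_def \<beta>_def by (intro orbit_INT L[OF i] pairs_at_sub) (use x in auto)
      then show "C i \<inter> C (Suc i mod 3) \<noteq> {}" by (auto simp: C_def j_def)
    qed (use N3 x \<beta>E in \<open>auto simp: C_def\<close>)
    then obtain i z where i: "i < 3" and "z \<in> C i" "z \<in> C (Suc i mod 3)" "z \<in> C (Suc (Suc i) mod 3)"
      by blast
    then have z: "z \<in> C 0" "z \<in> C 1" "z \<in> C 2" using less3[OF i] by (auto simp: numeral_2_eq_2)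
    have "K \<subseteq> edge z"
    proof
      fix c assume c: "c \<in> K"
      then have "c \<in> L 0 \<or> c \<in> L 1 \<or> c \<in> L 2" using a12 by (auto simp: L_def a_def)
      then obtain j where j: "c \<in> L j" "z \<in> C j" using z by blast
      then have "z \<in> orbit act (pairs_at S (p c)) (x j)"
        using orbit_mono[of "\<beta> j" "pairs_at S (p c)" act "x j"] by (auto simp: C_def \<beta>_def)
      moreover have "c \<in> edge (x j)" using x j by (auto simp: L_def)
      ultimately show "c \<in> edge z" using orbit_edge x by blast
    qed
    moreover have "z \<in> X" using z(1) orbit_subset[OF involutions_sub[OF \<beta>E[of 0]], of "x 0"] x[of 0]
      by (auto simp: C_def)
    ultimately show ?thesis by blast
  qed
qed

lemma adj_induced:
  assumes "a \<in> A0" "a' \<in> A0"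
  shows "gaifman_adj (induced_hyperedges U A0) a a' \<longleftrightarrow> gaifman_adj U a a'"
  using assms unfolding gaifman_adj_def induced_hyperedges_def by blast

lemma N_acyclic: "N_acyclic_hypergraph N A U"
  unfolding N_acyclic_hypergraph_def acyclic_hypergraph_def
proof (intro allI impI conjI notI)
  fix A0 assume A0: "A0 \<subseteq> A" "finite A0 \<and> card A0 \<le> N"
  assume "\<exists>c. chordless_cycle A0 (induced_hyperedges U A0) c \<and> 3 < length c"
  then obtain c where c: "chordless_cycle A0 (induced_hyperedges U A0) c" "3 < length c" by blast
  have A0c: "set c \<subseteq> A0" "distinct c" using c by (auto simp: chordless_cycle_def)
  have "length c \<le> N"
    using card_mono[of A0 "set c"] distinct_card[OF A0c(2)] A0 A0c(1) by simp
  moreover have "c ! i \<in> A0" if "i < length c" for i using A0c that nth_mem by blast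
  then have "chordless_cycle A U c"
    using c(1) A0c A0(1) adj_induced[of _ A0] by (auto simp: chordless_cycle_def)
  ultimately show False using no_chordless_cycle c(2) by blast
next
  fix A0 K assume A0: "A0 \<subseteq> A" "finite A0 \<and> card A0 \<le> N"
    and K: "gaifman_clique A0 (induced_hyperedges U A0) K"
  have sub: "K \<subseteq> A0" "K \<noteq> {}" using K by (auto simp: gaifman_clique_def)
  have "gaifman_clique A U K"
    using K A0(1) adj_induced[of _ A0] unfolding gaifman_clique_def by blast
  then obtain x where "x \<in> X" "K \<subseteq> edge x" using clique_in_edge finite_subset[OF sub(1)] A0 by blast
  then show "\<exists>u\<in>induced_hyperedges U A0. K \<subseteq> u"
    using sub unfolding induced_hyperedges_def by (intro bexI[of _ "edge x \<inter> A0"]) auto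
qed

lemma extend_symmetry:
  assumes h: "hypergraph_symmetry B S h" and \<phi>: "bij_betw \<phi> X X"
    and col_\<phi>: "\<And>x. x \<in> X \<Longrightarrow> col (\<phi> x) = h ` col x"
    and act_\<phi>: "\<And>x e. x \<in> X \<Longrightarrow> e \<in> S \<times> S \<Longrightarrow>
      \<phi> (act e x) = act (map_prod (image h) (image h) e) (\<phi> x)"
  obtains f where "covering_symmetry A U B S p f h" "\<And>x. x \<in> X \<Longrightarrow> f ` edge x = edge (\<phi> x)"
proof -
  define \<rho> where "\<rho> = map_prod (image h) (image h :: 'b set \<Rightarrow> 'b set)"
  have hB: "h permutes B" and hS: "image h ` S = S" using h by (auto simp: hypergraph_symmetry_def)
  have inj_h: "inj h" using permutes_inj[OF hB] .
  have \<phi>X: "\<phi> x \<in> X" if "x \<in> X" for x using \<phi> that by (auto simp: bij_betw_def)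
  have fold_\<phi>: "\<phi> (fold act w x) = fold act (map \<rho> w) (\<phi> x)" if "w \<in> lists (S \<times> S)" "x \<in> X" for w x
    using that
  proof (induction w arbitrary: x)
    case (Cons e w)
    then show ?case using act_\<phi>[of x e] act_in[of x e] by (simp add: \<rho>_def)
  qed simp
  have pairs: "pairs_at S (h b) = \<rho> ` pairs_at S b" for b
  proof
    show "\<rho> ` pairs_at S b \<subseteq> pairs_at S (h b)" using hS by (auto simp: pairs_at_def \<rho>_def)
    show "pairs_at S (h b) \<subseteq> \<rho> ` pairs_at S b"
    proof clarify
      fix t t' assume t: "(t, t') \<in> pairs_at S (h b)"
      then have "t \<in> image h ` S" "t' \<in> image h ` S" using hS by (auto simp: pairs_at_def)
      then obtain s s' where s: "s \<in> S" "s' \<in> S" "t = h ` s" "t' = h ` s'" by blast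
      then have "(s, s') \<in> pairs_at S b" using t inj_h by (auto simp: pairs_at_def inj_image_mem_iff)
      then show "(t, t') \<in> \<rho> ` pairs_at S b" using s by (force simp: \<rho>_def)
    qed
  qed
  have orbit_\<phi>: "orbit act (pairs_at S (h b)) (\<phi> x) = \<phi> ` orbit act (pairs_at S b) x" if "x \<in> X" for b x
  proof -
    have "lists (pairs_at S b) \<subseteq> lists (S \<times> S)" using lists_mono[OF pairs_at_sub] .
    then have "\<phi> ` orbit act (pairs_at S b) x = (\<lambda>w. fold act (map \<rho> w) (\<phi> x)) ` lists (pairs_at S b)"
      unfolding orbit_def image_image using fold_\<phi>[OF _ that] by (intro image_cong) blast+
    then show ?thesis unfolding orbit_def pairs lists_image image_image by simp
  qed
  have vert_\<phi>: "vert (h b) (\<phi> x) = vert (h c) (\<phi> y)"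
    if "x \<in> X" "y \<in> X" "b \<in> col x" "c \<in> col y" "vert b x = vert c y" for b c x y
  proof -
    have "b = c" "y \<in> orbit act (pairs_at S b) x" using vert_eq_iff that by blast+
    then show ?thesis using vert_eq_iff[of "\<phi> x" "\<phi> y" "h b" "h c"] \<phi>X col_\<phi> orbit_\<phi> that by auto
  qed
  have "\<forall>a\<in>A. \<exists>a'. \<exists>x b. x \<in> X \<and> b \<in> col x \<and> a = vert b x \<and> a' = vert (h b) (\<phi> x)"
    by (auto simp: edge_def)
  from bchoice[OF this] obtain f0
    where f0: "\<And>a. a \<in> A \<Longrightarrow> \<exists>x b. x \<in> X \<and> b \<in> col x \<and> a = vert b x \<and> f0 a = vert (h b) (\<phi> x)"
    by blast
  define f where "f a = (if a \<in> A then f0 a else a)" for a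
  have f: "f (vert b x) = vert (h b) (\<phi> x)" if "x \<in> X" "b \<in> col x" for b x
  proof -
    have "vert b x \<in> A" using that by (auto simp: edge_def)
    then show ?thesis using f0 vert_\<phi> that by (metis f_def)
  qed
  have f_edge: "f ` edge x = edge (\<phi> x)" if "x \<in> X" for x
    unfolding edge_def col_\<phi>[OF that] image_image using f[OF that] by (intro image_cong) auto
  have U: "image f ` U = U"
  proof -
    have "image f ` U = edge ` (\<phi> ` X)" unfolding image_image using f_edge by (intro image_cong) auto
    then show ?thesis using \<phi> by (simp add: bij_betw_def)
  qed
  have "f ` A = A" using U by (metis image_Union)
  then have "bij_betw f A A" using finite_A by (simp add: bij_betw_def eq_card_imp_inj_on)
  then have "f permutes A" by (rule bij_imp_permutes) (auto simp: f_def)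
  moreover have "p (f a) = h (p a)" if a: "a \<in> A" for a
  proof -
    obtain x b where xb: "x \<in> X" "b \<in> col x" "a = vert b x" using a by (auto simp: edge_def)
    then show ?thesis using f p_vert[OF \<phi>X, of x "h b"] p_vert col_\<phi> by simp
  qed
  ultimately have "covering_symmetry A U B S p f h"
    using U h by (simp add: covering_symmetry_def hypergraph_symmetry_def)
  then show thesis using that f_edge by blast
qed

end

context generators begin

definition word_class :: "'e list \<Rightarrow> 'e list set" where
  "word_class w = {w' \<in> lists E. \<forall>b. admissible E b \<longrightarrow> fold b w' = fold b w}"

definition right_mult :: "'e \<Rightarrow> 'e list set \<Rightarrow> 'e list set" where
  "right_mult e c = {w \<in> lists E. w @ [e] \<in> c}"

definition left_mult :: "'e list \<Rightarrow> 'e list set \<Rightarrow> 'e list set" where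
  "left_mult u c = {w \<in> lists E. rev u @ w \<in> c}"

lemma admissible_inv: "admissible E b \<Longrightarrow> involutions_on UNIV E b"
  by (auto simp: admissible_def involutions_on_def fun_eq_iff)

lemma word_class_eq_iff:
  assumes "w \<in> lists E"
  shows "word_class w = word_class w' \<longleftrightarrow> (\<forall>b. admissible E b \<longrightarrow> fold b w = fold b w')"
proof
  assume "word_class w = word_class w'"
  moreover have "w \<in> word_class w" using assms by (simp add: word_class_def)
  ultimately show "\<forall>b. admissible E b \<longrightarrow> fold b w = fold b w'" by (simp add: word_class_def)
qed (simp add: word_class_def)

lemma right_mult_class:
  assumes "e \<in> E"
  shows "right_mult e (word_class w) = word_class (w @ [e])"
proof -
  have "b e \<circ> f = g \<longleftrightarrow> f = b e \<circ> g" if "admissible E b" for b and f g :: "nat \<Rightarrow> nat"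
  proof -
    have "b e (b e k) = k" for k using admissible_inv[OF that] assms by (simp add: involutions_on_def)
    then show ?thesis by (metis comp_def fun_eq_iff)
  qed
  then show ?thesis using assms by (auto simp: right_mult_def word_class_def)
qed

lemma left_mult_class:
  assumes "u \<in> lists E"
  shows "left_mult u (word_class w) = word_class (u @ w)"
proof -
  have "f \<circ> fold b (rev u) = g \<longleftrightarrow> f = g \<circ> fold b u" if "admissible E b" for b and f g :: "nat \<Rightarrow> nat"
  proof -
    note inv = admissible_inv[OF that]
    have "fold b (rev u) (fold b u k) = k" for k using fold_rev_fold[OF inv assms] by simp
    moreover have "fold b u (fold b (rev u) k) = k" for k
      using fold_rev_fold[OF inv, of "rev u"] assms by (simp add: in_lists_conv_set)
    ultimately show ?thesis by (auto simp: fun_eq_iff) metis+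
  qed
  then show ?thesis using assms by (auto simp: left_mult_def word_class_def in_lists_conv_set)
qed

lemma word_class_iff:
  assumes "w \<in> lists E" "w' \<in> lists E"
  shows "w' \<in> word_class w \<longleftrightarrow> w' @ rev w \<in> relators E"
proof -
  have "fold b (w' @ rev w) = id \<longleftrightarrow> fold b w' = fold b w" if "admissible E b" for b
    using fold_append_rev[OF admissible_inv[OF that] assms(2,1)] by (simp only: fun_eq_iff id_apply) simp
  then show ?thesis using assms by (auto simp: word_class_def relators_iff in_lists_conv_set)
qed

lemma map_word_class:
  assumes \<rho>: "bij_betw \<rho> E E" and w: "w \<in> lists E"
  shows "map \<rho> ` word_class w = word_class (map \<rho> w)"
proof -
  define \<sigma> where "\<sigma> = inv_into E \<rho>"
  have \<rho>E: "\<rho> ` E = E" "inj_on \<rho> E" using \<rho> by (auto simp: bij_betw_def)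
  have "bij_betw \<sigma> E E" unfolding \<sigma>_def using bij_betw_inv_into[OF \<rho>] .
  then have \<sigma>E: "\<sigma> ` E = E" "inj_on \<sigma> E" by (auto simp: bij_betw_def)
  have map_lists: "map \<rho> u \<in> lists E" "map \<sigma> u \<in> lists E" if "u \<in> lists E" for u
    using that \<rho>E(1) \<sigma>E(1) by (auto simp: in_lists_conv_set)
  have \<sigma>\<rho>: "map \<sigma> (map \<rho> u) = u" and \<rho>\<sigma>: "map \<rho> (map \<sigma> u) = u" if "u \<in> lists E" for u
    using that \<rho>E by (auto simp: \<sigma>_def map_idI in_lists_conv_set f_inv_into_f)
  have iff: "map \<rho> u \<in> relators E \<longleftrightarrow> u \<in> relators E" if "u \<in> lists E" for u
    using relators_map[of \<rho> E u] relators_map[of \<sigma> E "map \<rho> u"] \<rho>E \<sigma>E \<sigma>\<rho>[OF that] by auto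
  have *: "map \<rho> u \<in> word_class (map \<rho> w) \<longleftrightarrow> u \<in> word_class w" if "u \<in> lists E" for u
    using iff[of "u @ rev w"] word_class_iff map_lists w that by (simp add: rev_map in_lists_conv_set ball_Un)
  show ?thesis
  proof
    show "map \<rho> ` word_class w \<subseteq> word_class (map \<rho> w)" using * by (auto simp: word_class_def)
    show "word_class (map \<rho> w) \<subseteq> map \<rho> ` word_class w"
    proof
      fix v assume v: "v \<in> word_class (map \<rho> w)"
      then have "v \<in> lists E" by (simp add: word_class_def)
      then show "v \<in> map \<rho> ` word_class w"
        using *[of "map \<sigma> v"] \<rho>\<sigma> map_lists v by (metis imageI)
    qed
  qed
qed

lemma word_class_cancel:
  assumes "v \<in> lists E" "w \<in> lists E"
  shows "word_class (v @ rev v @ w) = word_class w" "word_class (w @ rev v @ v) = word_class w"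
proof -
  have "fold b v (fold b (rev v) k) = k" "fold b (rev v) (fold b v k) = k" if "admissible E b" for b k
    using fold_rev_fold[OF admissible_inv[OF that], of "rev v"] fold_rev_fold[OF admissible_inv[OF that], of v] assms
    by (simp_all add: in_lists_conv_set)
  then show "word_class (v @ rev v @ w) = word_class w" "word_class (w @ rev v @ v) = word_class w"
    by (simp_all add: word_class_def o_def cong: conj_cong)
qed

end

lemma bij_betw_finite_image: "finite X \<Longrightarrow> f ` X = X \<Longrightarrow> bij_betw f X X"
  by (simp add: bij_betw_def eq_card_imp_inj_on)

lemma image_transpose: "inj f \<Longrightarrow> f (transpose a b c) = transpose (f a) (f b) (f c)"
  by (auto simp: transpose_def inj_eq)

theorem corollary5p4:
  fixes N :: nat and B :: "'b set" and S :: "'b set set"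
  assumes "hypergraph B S" and "finite B"
  shows "\<exists>(A :: nat set) (U :: nat set set) (p :: nat \<Rightarrow> 'b).
           hypergraph A U \<and> finite A \<and>
           N_acyclic_hypergraph N A U \<and>
           hypergraph_covering A U B S p \<and>
           fully_symmetric_over A U B S p"
proof -
  define M where "M = max N 3"
  have "S \<subseteq> Pow B" using assms(1) by (auto simp: hypergraph_def)
  then have finS: "finite S" using assms(2) finite_subset by blast
  interpret G: generators "S \<times> S" M "card S" by unfold_locales (simp add: finS)
  define \<sigma> :: "'b set \<times> 'b set \<Rightarrow> 'b set \<Rightarrow> 'b set" where "\<sigma> e = transpose (fst e) (snd e)" for e
  have \<sigma>: "involutions_on S (S \<times> S) \<sigma>"
    by (auto simp: involutions_on_def \<sigma>_def transpose_def)
  define cl where "cl = G.word_class"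
  define X where "X = S \<times> cl ` lists (S \<times> S)"
  define act where "act e = map_prod (\<sigma> e) (G.right_mult e)" for e
  have act_class: "act e (s, cl v) = (\<sigma> e s, cl (v @ [e]))" if "e \<in> S \<times> S" for e s v
    using G.right_mult_class[OF that] by (simp add: act_def cl_def)
  have fold_class: "fold act w (s, cl v) = (fold \<sigma> w s, cl (v @ w))" if "w \<in> lists (S \<times> S)" for w s v
    using that by (induction w arbitrary: s v rule: lists.induct) (simp_all add: act_class)
  have X_E: thesis if "x \<in> X" "\<And>s v. s \<in> S \<Longrightarrow> v \<in> lists (S \<times> S) \<Longrightarrow> x = (s, cl v) \<Longrightarrow> thesis" for x thesis
    using that by (auto simp: X_def)
  have X_I: "(s, cl v) \<in> X" if "s \<in> S" "v \<in> lists (S \<times> S)" for s v using that by (auto simp: X_def)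
  have act_inv: "involutions_on X (S \<times> S) act"
    unfolding involutions_on_def
  proof (intro ballI)
    fix e x assume e: "e \<in> S \<times> S" and "x \<in> X"
    then obtain s v where x: "s \<in> S" "v \<in> lists (S \<times> S)" "x = (s, cl v)" by (blast elim: X_E)
    have "\<sigma> e s \<in> S" "\<sigma> e (\<sigma> e s) = s" using \<sigma> e x(1) by (auto simp: involutions_on_def)
    moreover have "cl ((v @ [e]) @ [e]) = cl v" using G.word_class_cancel(2)[of "[e]" v] e x by (simp add: cl_def)
    ultimately show "act e x \<in> X \<and> act e (act e x) = x"
      using e x(2) act_class[OF e] X_I[of "\<sigma> e s" "v @ [e]"] by (simp add: x(3))
  qed
  interpret F: free_action "S \<times> S" M "card S" X act
  proof
    fix w x assume w: "w \<in> lists (S \<times> S)" and "x \<in> X"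
    then obtain s v where x: "s \<in> S" "v \<in> lists (S \<times> S)" "x = (s, cl v)" by (blast elim: X_E)
    have vw: "v @ w \<in> lists (S \<times> S)" using w x by simp
    show "fold act w x = x \<longleftrightarrow> w \<in> G.relators (S \<times> S)"
    proof
      assume "fold act w x = x"
      then have "cl (v @ w) = cl v" using fold_class[OF w] x by simp
      then have *: "fold b w \<circ> fold b v = fold b v" if "G.admissible (S \<times> S) b" for b
        using G.word_class_eq_iff[OF vw] that by (simp add: cl_def)
      have "fold b w = id" if b: "G.admissible (S \<times> S) b" for b
      proof
        fix k
        have "fold b v (fold b (rev v) k) = k"
          using fold_rev_fold[OF G.admissible_inv[OF b], of "rev v" k] x(2) by (simp add: in_lists_conv_set)
        then show "fold b w k = id k" using fun_cong[OF *[OF b], of "fold b (rev v) k"] by simp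
      qed
      then show "w \<in> G.relators (S \<times> S)" using G.relators_iff[OF order_refl] w by blast
    next
      assume r: "w \<in> G.relators (S \<times> S)"
      then have "fold \<sigma> w s = s"
        by (intro G.relators_fold_small[OF order_refl _ finS order_refl \<sigma> x(1)])
      moreover have "fold b w = id" if "G.admissible (S \<times> S) b" for b
        using r that G.relators_iff[OF order_refl] by blast
      then have "cl (v @ w) = cl v" using G.word_class_eq_iff[OF vw] by (simp add: cl_def)
      ultimately show "fold act w x = x" using fold_class[OF w] x by simp
    qed
  qed (rule act_inv)
  have finX: "finite X"
  proof (cases "S = {}")
    case False
    then obtain s where s: "s \<in> S" by blast
    have "(s, cl []) \<in> X" using X_I[OF s] by simp
    then have "finite (snd ` orbit act (S \<times> S) (s, cl []))" using F.card_orbit(1)[OF order_refl] by blast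
    moreover have "snd ` orbit act (S \<times> S) (s, cl []) = cl ` lists (S \<times> S)"
      unfolding orbit_def image_image by (intro image_cong) (simp_all add: fold_class)
    ultimately show ?thesis using finS by (simp add: X_def)
  qed (simp add: X_def)
  define V where "V = (\<lambda>(b, x). (b, orbit act (pairs_at S b) x)) ` (B \<times> X)"
  have "finite V" using assms(2) finX by (simp add: V_def)
  then obtain code :: "_ \<Rightarrow> nat" where code: "inj_on code V" using finite_imp_inj_to_nat_seg by blast
  define vert where "vert b x = code (b, orbit act (pairs_at S b) x)" for b x
  define p where "p k = fst (inv_into V code k)" for k
  have in_V: "(b, orbit act (pairs_at S b) x) \<in> V" if "x \<in> X" "b \<in> fst x" for b x
  proof -
    have "fst x \<in> S" using that(1) by (auto simp: X_def)
    then have "b \<in> B" using that(2) \<open>S \<subseteq> Pow B\<close> by blast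
    then show ?thesis using that by (auto simp: V_def)
  qed
  interpret C: orbit_cover S M "card S" X act B fst vert p
  proof
    show "3 \<le> M" by (simp add: M_def)
    show "hypergraph B S" by (rule assms(1))
    show "finite X" by (rule finX)
    have "cl ` lists (S \<times> S) \<noteq> {}" by (metis empty_iff image_is_empty lists.Nil)
    then show "fst ` X = S" by (simp add: X_def)
  next
    fix x :: "'b set \<times> ('b set \<times> 'b set) list set" and e
    show "fst (act e x) = transpose (fst e) (snd e) (fst x)" by (simp add: act_def \<sigma>_def)
  next
    fix x y b c assume x: "x \<in> X" and y: "y \<in> X" and b: "b \<in> fst x" and c: "c \<in> fst y"
    have "vert b x = vert c y \<longleftrightarrow> b = c \<and> orbit act (pairs_at S b) x = orbit act (pairs_at S b) y"
      using inj_on_eq_iff[OF code in_V[OF x b] in_V[OF y c]] by (auto simp: vert_def)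
    moreover have "orbit act (pairs_at S b) x = orbit act (pairs_at S b) y \<longleftrightarrow> y \<in> orbit act (pairs_at S b) x"
      using orbit_eq[OF F.involutions_sub[OF pairs_at_sub] x] orbit_refl by metis
    ultimately show "vert b x = vert c y \<longleftrightarrow> b = c \<and> y \<in> orbit act (pairs_at S b) x" by simp
  next
    fix x b assume "x \<in> X" "b \<in> fst x"
    then show "p (vert b x) = b" using in_V code by (simp add: p_def vert_def)
  qed
  have "N_acyclic_hypergraph N C.A C.U"
    using C.N_acyclic by (auto simp: N_acyclic_hypergraph_def M_def)
  moreover have "hypergraph C.A C.U" using C.finite_edge by (auto simp: hypergraph_def)
  moreover have "fully_symmetric_over C.A C.U B S p"
    unfolding fully_symmetric_over_def
  proof (intro conjI allI impI ballI)
    fix h assume h: "hypergraph_symmetry B S h"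
    then have inj_h: "inj h" and hS: "image h ` S = S"
      using permutes_inj by (auto simp: hypergraph_symmetry_def)
    have inj_image: "inj (image h)" by (intro injI) (simp add: inj_image_eq_iff[OF inj_h])
    define \<rho> where "\<rho> = map_prod (image h) (image h :: 'b set \<Rightarrow> 'b set)"
    have \<rho>S: "\<rho> ` (S \<times> S) = S \<times> S" unfolding \<rho>_def using hS by (simp add: map_prod_surj_on)
    then have bij_\<rho>: "bij_betw \<rho> (S \<times> S) (S \<times> S)" using finS by (intro bij_betw_finite_image) simp_all
    have map_cl: "image (map \<rho>) (cl w) = cl (map \<rho> w)" if "w \<in> lists (S \<times> S)" for w
      using G.map_word_class[OF bij_\<rho> that] by (simp add: cl_def)
    define \<phi> where "\<phi> = map_prod (image h) (image (map \<rho>))"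
    have \<phi>_class: "\<phi> (s, cl w) = (h ` s, cl (map \<rho> w))" if "w \<in> lists (S \<times> S)" for s w
      using map_cl[OF that] by (simp add: \<phi>_def)
    have "image (map \<rho>) ` cl ` lists (S \<times> S) = cl ` map \<rho> ` lists (S \<times> S)"
      unfolding image_image using map_cl by (intro image_cong) auto
    also have "\<dots> = cl ` lists (S \<times> S)" by (metis \<rho>S lists_image)
    finally have "\<phi> ` X = X" unfolding \<phi>_def X_def by (intro map_prod_surj_on hS)
    then have bij_\<phi>: "bij_betw \<phi> X X" using finX by (intro bij_betw_finite_image)
    show "\<exists>f. covering_symmetry C.A C.U B S p f h"
    proof (rule C.extend_symmetry[OF h bij_\<phi>])
      fix x e assume "x \<in> X" and e: "e \<in> S \<times> S"
      then obtain s v where x: "s \<in> S" "v \<in> lists (S \<times> S)" "x = (s, cl v)" by (blast elim: X_E)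
      have \<rho>e: "\<rho> e \<in> S \<times> S" using \<rho>S e by blast
      have "\<phi> (act e x) = (h ` \<sigma> e s, cl (map \<rho> v @ [\<rho> e]))"
        using \<phi>_class[of "v @ [e]" "\<sigma> e s"] act_class[OF e] e x by simp
      also have "h ` \<sigma> e s = \<sigma> (\<rho> e) (h ` s)"
        unfolding \<sigma>_def \<rho>_def image_transpose[OF inj_image] by simp
      finally show "\<phi> (act e x) = act (map_prod (image h) (image h) e) (\<phi> x)"
        using act_class[OF \<rho>e] \<phi>_class[OF x(2)] x(3) by (simp add: \<rho>_def)
    qed (auto simp: \<phi>_def)
  next
    fix s u u' assume s: "s \<in> S" and u: "u \<in> {u \<in> C.U. p ` u = s}" "u' \<in> {u \<in> C.U. p ` u = s}"
    then obtain x y where xy: "x \<in> X" "u = C.edge x" "y \<in> X" "u' = C.edge y" by blast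
    then have "fst x = s" "fst y = s" using u C.p_edge by auto
    then obtain v v' where v: "v \<in> lists (S \<times> S)" "x = (s, cl v)" and v': "v' \<in> lists (S \<times> S)" "y = (s, cl v')"
      using xy by (metis X_E fst_conv)
    define k where "k = v' @ rev v"
    have k: "k \<in> lists (S \<times> S)" using v v' by (simp add: k_def in_lists_conv_set ball_Un)
    define \<phi> where "\<phi> = map_prod (id :: 'b set \<Rightarrow> 'b set) (G.left_mult k)"
    have \<phi>_class: "\<phi> (t, cl w) = (t, cl (k @ w))" for t w
      using G.left_mult_class[OF k] by (simp add: \<phi>_def cl_def)
    have \<phi>x: "\<phi> x = y" unfolding v(2) v'(2) \<phi>_class k_def
      using G.word_class_cancel(2)[OF v(1) v'(1)] by (simp add: cl_def)
    have "G.left_mult k ` cl ` lists (S \<times> S) = cl ` lists (S \<times> S)"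
    proof
      show "G.left_mult k ` cl ` lists (S \<times> S) \<subseteq> cl ` lists (S \<times> S)"
        unfolding image_image cl_def G.left_mult_class[OF k] using k
        by (intro image_subsetI imageI) (simp add: in_lists_conv_set ball_Un)
      show "cl ` lists (S \<times> S) \<subseteq> G.left_mult k ` cl ` lists (S \<times> S)"
      proof
        fix c assume "c \<in> cl ` lists (S \<times> S)"
        then obtain w where w: "w \<in> lists (S \<times> S)" "c = cl w" by blast
        then have "c = G.left_mult k (cl (rev k @ w))"
          using G.word_class_cancel(1)[OF k w(1)] G.left_mult_class[OF k] by (simp add: cl_def)
        moreover have "rev k @ w \<in> lists (S \<times> S)" using k w by (simp add: in_lists_conv_set ball_Un)
        ultimately show "c \<in> G.left_mult k ` cl ` lists (S \<times> S)" by blast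
      qed
    qed
    then have "\<phi> ` X = X" unfolding \<phi>_def X_def by (intro map_prod_surj_on) auto
    then have bij_\<phi>: "bij_betw \<phi> X X" using finX by (intro bij_betw_finite_image)
    have id: "hypergraph_symmetry B S id" by (simp add: hypergraph_symmetry_def permutes_id)
    show "\<exists>f. covering_symmetry C.A C.U B S p f id \<and> f ` u = u'"
    proof (rule C.extend_symmetry[OF id bij_\<phi>])
      fix x e assume "x \<in> X" and e: "e \<in> S \<times> S"
      then obtain t w where x: "x = (t, cl w)" by (blast elim: X_E)
      have "map_prod (image id) (image id) e = e" by (cases e) simp
      then show "\<phi> (act e x) = act (map_prod (image id) (image id) e) (\<phi> x)"
        using act_class[OF e] \<phi>_class by (simp add: x)
    next
      fix f assume "covering_symmetry C.A C.U B S p f id" "\<And>x. x \<in> X \<Longrightarrow> f ` C.edge x = C.edge (\<phi> x)"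
      then show ?thesis using xy \<phi>x by blast
    qed (auto simp: \<phi>_def)
  qed
  ultimately show ?thesis using C.finite_A C.covering by blast
qed

end
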